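(* Let $X$ be a Tychonoff space. If $\beta X$ is a submaximal space, then $X$ is compact. In this case $\beta X=X$.
   Context: A topological space is submaximal if every dense subset is open. A Tychonoff space is a completely regular Hausdorff space, and $\beta X$ denotes the Stone-Čech compactification of $X$. *)

theory Defs
  imports "HOL-Analysis.Analysis"
begin

definition submaximal_space :: "'a topology \<Rightarrow> bool" where
  "submaximal_space X \<longleftrightarrow>
     (\<forall>D \<subseteq> topspace X. X closure_of D = topspace X \<longrightarrow> openin X D)"

text \<open>The Stone-Cech compactification is the closure of the canonical image of the space in the
  cube indexed by its continuous functions into the unit interval. Functions are restricted to be
  extensional so that each continuous function contributes exactly one coordinate.\<close>

definition unit_functions :: "'a topology \<Rightarrow> ('a \<Rightarrow> real) set" where
  "unit_functions X =
     {f \<in> extensional (topspace X). continuous_map X (top_of_set {0..1}) f}"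

definition unit_cube :: "'a topology \<Rightarrow> (('a \<Rightarrow> real) \<Rightarrow> real) topology" where
  "unit_cube X = product_topology (\<lambda>f. top_of_set {0..1}) (unit_functions X)"

definition stone_cech_map :: "'a topology \<Rightarrow> 'a \<Rightarrow> ('a \<Rightarrow> real) \<Rightarrow> real" where
  "stone_cech_map X x = (\<lambda>f \<in> unit_functions X. f x)"

definition stone_cech :: "'a topology \<Rightarrow> (('a \<Rightarrow> real) \<Rightarrow> real) topology" where
  "stone_cech X =
     subtopology (unit_cube X) (unit_cube X closure_of (stone_cech_map X ` topspace X))"

text \<open>The remaining facts show that this is a Hausdorff compactification with the
  extension property.\<close>

lemma compact_space_unit_cube: "compact_space (unit_cube X)"
  by (simp add: unit_cube_def compact_space_product_topology compact_space_subtopology)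

lemma Hausdorff_space_unit_cube: "Hausdorff_space (unit_cube X)"
  by (simp add: unit_cube_def Hausdorff_space_product_topology Hausdorff_space_subtopology)

lemma compact_space_stone_cech: "compact_space (stone_cech X)"
  unfolding stone_cech_def
  by (intro compact_space_subtopology closedin_compact_space compact_space_unit_cube
      closedin_closure_of)

lemma Hausdorff_space_stone_cech: "Hausdorff_space (stone_cech X)"
  by (simp add: stone_cech_def Hausdorff_space_subtopology Hausdorff_space_unit_cube)

lemma continuous_map_stone_cech_map_cube: "continuous_map X (unit_cube X) (stone_cech_map X)"
  by (auto simp: unit_cube_def continuous_map_componentwise stone_cech_map_def unit_functions_def)

lemma stone_cech_map_image_subset: "stone_cech_map X ` topspace X \<subseteq> topspace (unit_cube X)"
  using continuous_map_stone_cech_map_cube by (rule continuous_map_image_subset_topspace)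

lemma topspace_stone_cech:
  "topspace (stone_cech X) = unit_cube X closure_of (stone_cech_map X ` topspace X)"
  by (simp add: stone_cech_def closure_of_subset_topspace inf.absorb2)

lemma stone_cech_map_image_subset': "stone_cech_map X ` topspace X \<subseteq> topspace (stone_cech X)"
  by (simp add: topspace_stone_cech closure_of_subset stone_cech_map_image_subset)

lemma dense_stone_cech_map:
  "stone_cech X closure_of (stone_cech_map X ` topspace X) = topspace (stone_cech X)"
  using stone_cech_map_image_subset'[of X] unfolding topspace_stone_cech
  by (simp add: stone_cech_def closure_of_subtopology inf.absorb2)

lemma embedding_map_stone_cech_map:
  assumes "completely_regular_space X" "Hausdorff_space X"
  shows "embedding_map X (stone_cech X) (stone_cech_map X)"
proof -
  have "bounded (f ` topspace X)" if "\<forall>x \<in> topspace X. 0 \<le> f x \<and> f x \<le> 1" for f :: "'a \<Rightarrow> real"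
    by (rule bounded_subset[OF bounded_closed_interval[of 0 1]]) (use that in auto)
  then have eq: "mspace (submetric (cfunspace X euclidean_metric) {f. f \<in> topspace X \<rightarrow> {0..1}})
      = unit_functions X"
    by (auto simp: unit_functions_def continuous_map_in_subtopology Pi_iff image_subset_iff)
  have "embedding_map X (unit_cube X) (stone_cech_map X)"
    using completely_regular_space_cube_embedding_explicit[OF assms]
    unfolding eq unit_cube_def stone_cech_map_def .
  then show ?thesis
    using stone_cech_map_image_subset'[of X]
    by (simp add: stone_cech_def topspace_stone_cech embedding_map_in_subtopology)
qed

lemma stone_cech_extension:
  assumes g: "continuous_map X K g" and K: "compact_space K" "Hausdorff_space K"
  obtains h where "continuous_map (stone_cech X) K h"
    "\<And>x. x \<in> topspace X \<Longrightarrow> h (stone_cech_map X x) = g x"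
proof -
  define e where "e = stone_cech_map K"
  have emb: "embedding_map K (stone_cech K) e"
    unfolding e_def
    by (intro embedding_map_stone_cech_map K normal_imp_completely_regular_space
        compact_Hausdorff_or_regular_imp_normal_space) (use K in auto)
  have "closedin (unit_cube K) (e ` topspace K)"
    by (metis K(1) Hausdorff_space_unit_cube compactin_imp_closedin compact_space_def e_def
        continuous_map_stone_cech_map_cube image_compactin)
  then have cle: "unit_cube K closure_of (e ` topspace K) = e ` topspace K"
    by (rule closure_of_closedin)
  then have homeo: "homeomorphic_map K (stone_cech K) e"
    using emb by (simp add: e_def topspace_stone_cech flip: surjective_embedding_map)
  then obtain r where r: "homeomorphic_maps K (stone_cech K) e r"
    using homeomorphic_map_maps by blast
  define p where "p k = restrict (k \<circ> g) (topspace X)" for k :: "'b \<Rightarrow> real"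
  have p: "p k \<in> unit_functions X" if "k \<in> unit_functions K" for k
  proof -
    have "continuous_map X (top_of_set {0..1}) (k \<circ> g)"
      using that g by (auto simp: unit_functions_def intro: continuous_map_compose)
    then have "continuous_map X (top_of_set {0..1}) (p k)"
      by (rule continuous_map_eq) (simp add: p_def)
    then show ?thesis
      by (simp add: unit_functions_def p_def)
  qed
  define \<phi> where "\<phi> z = (\<lambda>k \<in> unit_functions K. z (p k))" for z :: "('a \<Rightarrow> real) \<Rightarrow> real"
  have \<phi>: "continuous_map (unit_cube X) (unit_cube K) \<phi>"
    using p by (auto simp: unit_cube_def continuous_map_componentwise \<phi>_def
        intro: continuous_map_product_projection)
  have \<phi>e: "\<phi> (stone_cech_map X x) = e (g x)" if "x \<in> topspace X" for x
    using that p by (auto simp: \<phi>_def e_def stone_cech_map_def p_def)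
  have gim: "g ` topspace X \<subseteq> topspace K"
    by (rule continuous_map_image_subset_topspace[OF g])
  have "\<phi> ` topspace (stone_cech X)
      \<subseteq> unit_cube K closure_of (\<phi> ` stone_cech_map X ` topspace X)"
    unfolding topspace_stone_cech by (rule continuous_map_image_closure_subset[OF \<phi>])
  also have "\<dots> \<subseteq> unit_cube K closure_of (e ` topspace K)"
    using gim \<phi>e by (intro closure_of_mono) auto
  finally have "\<phi> ` topspace (stone_cech X) \<subseteq> topspace (stone_cech K)"
    unfolding topspace_stone_cech e_def .
  moreover have "continuous_map (stone_cech X) (unit_cube K) \<phi>"
    unfolding stone_cech_def by (rule continuous_map_from_subtopology[OF \<phi>])
  ultimately have "continuous_map (stone_cech X) (stone_cech K) \<phi>"
    unfolding topspace_stone_cech[of K] stone_cech_def[of K]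
    by (auto simp: continuous_map_in_subtopology)
  then have "continuous_map (stone_cech X) K (r \<circ> \<phi>)"
    using r by (auto simp: homeomorphic_maps_def intro: continuous_map_compose)
  moreover have "(r \<circ> \<phi>) (stone_cech_map X x) = g x" if "x \<in> topspace X" for x
    using that gim r \<phi>e by (auto simp: homeomorphic_maps_def)
  ultimately show thesis
    using that by blast
qed

end

theory Submission
  imports Defs
begin

text \<open>
  The idea is that submaximality turns \<open>K = \<beta>X\<close> into a space with only finitely many non-isolated
  points, and that near such a point \<open>K\<close> looks like the one-point compactification of an infinite
  discrete space, which is far from being a Stone-Cech compactification of the complement of that
  point.

  In a compact submaximal space every dense set has finite complement
  (\<open>submaximal_compact_dense_cofinite\<close>). If infinitely many points of \<open>K\<close> were not isolated, they
  would accumulate somewhere, and near the accumulation point one could choose an infinite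
  relatively discrete set \<open>D\<close> of non-isolated points
  (\<open>infinite_relatively_discrete_subset\<close>). Each point of \<open>D\<close> is then a limit of points
  outside \<open>D\<close>, so the complement of \<open>D\<close> is dense although \<open>D\<close> is infinite. Hence the set of
  non-isolated points is finite (\<open>submaximal_compact_finite_derived_set\<close>).

  Now suppose that \<open>p\<close> lies in \<open>K\<close> but not in the image of \<open>X\<close>. Since the image is dense and
  misses \<open>p\<close>, the point \<open>p\<close> is not isolated, and it has a closed neighbourhood \<open>C\<close> all of whose
  other points are isolated. These infinitely many points lie in the image of \<open>X\<close>; any infinite set
  of them accumulates at \<open>p\<close> and nowhere else. Two disjoint infinite sets \<open>A\<close> and \<open>B\<close> of them
  therefore have \<open>p\<close> in both closures. But \<open>A\<close> is clopen in \<open>X\<close>, so its indicator function extends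
  continuously to \<open>K\<close>, and the extension would be both 1 and 0 at \<open>p\<close>. So the canonical map is onto,
  and being an embedding it is a homeomorphism onto a compact space.
\<close>

text \<open>At an accumulation point \<^term>\<open>q\<close> of the complement of \<^term>\<open>D\<close>, the dense and hence open set
  \<^term>\<open>insert q D\<close> would be a neighbourhood meeting that complement in at most \<^term>\<open>q\<close>.\<close>

lemma submaximal_compact_dense_cofinite:
  assumes K: "submaximal_space K" "compact_space K"
    and D: "D \<subseteq> topspace K" "K closure_of D = topspace K"
  shows "finite (topspace K - D)"
proof (rule ccontr)
  assume inf: "infinite (topspace K - D)"
  obtain q where q: "q \<in> K derived_set_of (topspace K - D)"
    using compact_space_imp_Bolzano_Weierstrass[OF K(2) inf] by auto
  have sub: "insert q D \<subseteq> topspace K"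
    using q D(1) by (simp add: in_derived_set_of)
  have "K closure_of (insert q D) = topspace K"
    using closure_of_mono[of D "insert q D" K] closure_of_subset_topspace[of K "insert q D"] D(2)
    by blast
  then have "openin K (insert q D)"
    using K(1) sub by (simp add: submaximal_space_def)
  then obtain y where "y \<noteq> q" "y \<in> topspace K - D" "y \<in> insert q D"
    using q unfolding in_derived_set_of by blast
  then show False
    by blast
qed

lemma infinite_relatively_discrete_subset:
  assumes K: "Hausdorff_space K" and q: "q \<in> K derived_set_of S"
  obtains D where "D \<subseteq> S" "infinite D" "\<And>d. d \<in> D \<Longrightarrow> \<exists>V. openin K V \<and> V \<inter> D = {d}"
proof -
  have qK: "q \<in> topspace K"
    using q by (simp add: in_derived_set_of)
  \<comment> \<open>Each shrinking step of the neighbourhood of \<^term>\<open>q\<close> splits off a point of \<^term>\<open>S\<close> together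
    with a neighbourhood \<^term>\<open>V\<close> that all later points avoid.\<close>
  have "\<exists>U. \<forall>n. (openin K (U n) \<and> q \<in> U n) \<and>
    (U (Suc n) \<subseteq> U n \<and> (\<exists>x V. openin K V \<and> x \<in> V \<inter> S \<and> V \<subseteq> U n \<and> V \<inter> U (Suc n) = {}))"
  proof (rule dependent_nat_choice)
    show "\<exists>U. openin K U \<and> q \<in> U"
      using qK by blast
  next
    fix U assume U: "openin K U \<and> q \<in> U"
    then obtain x where x: "x \<noteq> q" "x \<in> S" "x \<in> U"
      using q unfolding in_derived_set_of by blast
    then have "x \<in> topspace K"
      using U openin_subset by blast
    then obtain V W where VW: "openin K V" "openin K W" "x \<in> V" "q \<in> W" "disjnt V W"
      using K x qK unfolding Hausdorff_space_def by blast
    have "openin K (V \<inter> U) \<and> x \<in> (V \<inter> U) \<inter> S \<and> V \<inter> U \<subseteq> U \<and> (V \<inter> U) \<inter> (W \<inter> U) = {}"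
      using VW x U by (auto simp: disjnt_def)
    moreover have "(openin K (W \<inter> U) \<and> q \<in> W \<inter> U) \<and> W \<inter> U \<subseteq> U"
      using VW U by auto
    ultimately show "\<exists>U'. (openin K U' \<and> q \<in> U') \<and>
        (U' \<subseteq> U \<and> (\<exists>x V. openin K V \<and> x \<in> V \<inter> S \<and> V \<subseteq> U \<and> V \<inter> U' = {}))"
      by blast
  qed
  then obtain U x V where dec: "\<And>n. U (Suc n) \<subseteq> U n"
    and V: "\<And>n. openin K (V n)" "\<And>n. V n \<subseteq> U n" "\<And>n. V n \<inter> U (Suc n) = {}"
    and x: "\<And>n. x n \<in> V n" "\<And>n. x n \<in> S"
    by (simp add: all_conj_distrib) metis
  have disj: "V i \<inter> V j = {}" if "i < j" for i j
  proof -
    have "U j \<subseteq> U (Suc i)"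
      using lift_Suc_antimono_le[of U, OF dec] that by simp
    then show ?thesis
      using V(2)[of j] V(3)[of i] by blast
  qed
  then have ne: "x j \<notin> V i" if "i \<noteq> j" for i j
    using x(1)[of j] that by (metis disjoint_iff nat_neq_iff)
  show thesis
  proof
    show "range x \<subseteq> S"
      using x(2) by blast
    have "inj x"
      using ne x(1) by (metis injI)
    then show "infinite (range x)"
      by (rule range_inj_infinite)
    show "\<exists>V. openin K V \<and> V \<inter> range x = {d}" if d: "d \<in> range x" for d
    proof -
      obtain i where i: "d = x i"
        using d by blast
      have "j = i" if "x j \<in> V i" for j
        using ne that by metis
      then have "V i \<inter> range x = {x i}"
        using x(1) by auto
      then show ?thesis
        using V(1) i by blast
    qed
  qed
qed

text \<open>A point of \<^term>\<open>D\<close> is not isolated in the whole space but is isolated within \<^term>\<open>D\<close>, so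
  points outside \<^term>\<open>D\<close> come arbitrarily close to it.\<close>

lemma dense_complement_of_relatively_discrete:
  assumes K: "D \<subseteq> K derived_set_of topspace K"
    and D: "\<And>d. d \<in> D \<Longrightarrow> \<exists>V. openin K V \<and> V \<inter> D = {d}"
  shows "K closure_of (topspace K - D) = topspace K"
  unfolding dense_intersects_open
proof (intro allI impI)
  fix T assume T: "openin K T \<and> T \<noteq> {}"
  show "(topspace K - D) \<inter> T \<noteq> {}"
  proof (cases "T \<inter> D = {}")
    case True
    then show ?thesis
      using T openin_subset by blast
  next
    case False
    then obtain d where "d \<in> T" "d \<in> D"
      by blast
    moreover from this obtain V where "openin K V" "V \<inter> D = {d}"
      using D by metis
    ultimately have d: "d \<in> T" "d \<in> D" "openin K V" "V \<inter> D = {d}"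
      by simp_all
    then have "openin K (T \<inter> V)" "d \<in> T \<inter> V"
      using T by auto
    moreover have "d \<in> K derived_set_of topspace K"
      using K d(2) by blast
    ultimately obtain y where "y \<noteq> d" "y \<in> topspace K" "y \<in> T \<inter> V"
      unfolding in_derived_set_of by blast
    then show ?thesis
      using d by blast
  qed
qed

lemma submaximal_compact_finite_derived_set:
  assumes K: "submaximal_space K" "compact_space K" "Hausdorff_space K"
  shows "finite (K derived_set_of topspace K)"
proof (rule ccontr)
  let ?N = "K derived_set_of topspace K"
  assume inf: "infinite ?N"
  obtain q where "q \<in> K derived_set_of ?N"
    using compact_space_imp_Bolzano_Weierstrass[OF K(2) inf derived_set_of_subset_topspace] by blast
  then obtain D where D: "D \<subseteq> ?N" "infinite D" "\<And>d. d \<in> D \<Longrightarrow> \<exists>V. openin K V \<and> V \<inter> D = {d}"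
    using infinite_relatively_discrete_subset[OF K(3)] by metis
  have "finite (topspace K - (topspace K - D))"
    using submaximal_compact_dense_cofinite[OF K(1,2)]
      dense_complement_of_relatively_discrete[OF D(1,3)] by blast
  moreover have "D \<subseteq> topspace K"
    using D(1) derived_set_of_subset_topspace by fastforce
  ultimately show False
    using D(2) by (simp add: double_diff)
qed

text \<open>The indicator function of a clopen set is continuous, and its extension to the
  compactification is constantly 1 on one closure and constantly 0 on the other.\<close>

lemma stone_cech_clopen_disjoint_closures:
  assumes U: "openin X U" "closedin X U"
  shows "stone_cech X closure_of (stone_cech_map X ` U) \<inter>
    stone_cech X closure_of (stone_cech_map X ` (topspace X - U)) = {}"
proof -
  let ?g = "\<lambda>x. if x \<in> U then 1 else 0 :: real"
  have "continuous_map X (top_of_set {0..1}) ?g"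
    unfolding continuous_map_in_subtopology
  proof
    have "openin X {x \<in> topspace X. ?g x \<in> W}" for W
    proof -
      have "{x \<in> topspace X. ?g x \<in> W} =
          (if 1 \<in> W then U else {}) \<union> (if 0 \<in> W then topspace X - U else {})"
        using openin_subset[OF U(1)] by auto
      then show ?thesis
        using U by auto
    qed
    then show "continuous_map X euclidean ?g"
      by (simp add: continuous_map_def)
  qed auto
  then obtain h where h: "continuous_map (stone_cech X) (top_of_set {0..1}) h"
      "\<And>x. x \<in> topspace X \<Longrightarrow> h (stone_cech_map X x) = ?g x"
    by (rule stone_cech_extension) (auto simp: compact_space_subtopology Hausdorff_space_subtopology)
  have hc: "continuous_map (stone_cech X) euclidean h"
    using h(1) by (simp add: continuous_map_in_subtopology)
  have val: "h z = c" if "z \<in> stone_cech X closure_of (stone_cech_map X ` S)"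
    "S \<subseteq> topspace X" "\<And>x. x \<in> S \<Longrightarrow> ?g x = c" for z S c
  proof -
    have "h ` stone_cech_map X ` S \<subseteq> {c}"
      using that h(2) by (auto simp: subset_iff)
    then have "euclidean closure_of (h ` stone_cech_map X ` S) \<subseteq> {c}"
      by (intro closure_of_minimal) auto
    then show ?thesis
      using continuous_map_image_closure_subset[OF hc, of "stone_cech_map X ` S"] that(1) by blast
  qed
  show ?thesis
  proof (rule ccontr)
    assume "\<not> ?thesis"
    then obtain z where "z \<in> stone_cech X closure_of (stone_cech_map X ` U)"
        "z \<in> stone_cech X closure_of (stone_cech_map X ` (topspace X - U))"
      by blast
    then have "h z = 1" "h z = 0"
      using val[of z U 1] val[of z "topspace X - U" 0] openin_subset[OF U(1)] by auto
    then show False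
      by simp
  qed
qed

text \<open>By compactness an infinite subset of \<^term>\<open>C\<close> has some accumulation point; it lies in the
  closed set \<^term>\<open>C\<close> and is not isolated, which leaves only \<^term>\<open>p\<close>.\<close>

lemma derived_set_of_infinite_subset_eq_singleton:
  assumes K: "compact_space K" and C: "closedin K C" "C \<inter> K derived_set_of topspace K \<subseteq> {p}"
    and A: "A \<subseteq> C" "infinite A"
  shows "K derived_set_of A = {p}"
proof -
  have AK: "A \<subseteq> topspace K"
    using A(1) closedin_subset[OF C(1)] by blast
  have "K derived_set_of A \<subseteq> C"
    using derived_set_of_mono[OF A(1), of K] C(1) unfolding closedin_contains_derived_set by blast
  moreover have "K derived_set_of A \<noteq> {}"
    using compact_space_imp_Bolzano_Weierstrass[OF K A(2) AK] .
  ultimately show ?thesis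
    using derived_set_of_mono[OF AK, of K] C(2) by blast
qed

lemma infinite_disjoint_halves:
  assumes "infinite S"
  obtains A B where "A \<subseteq> S" "B \<subseteq> S" "A \<inter> B = {}" "infinite A" "infinite B"
proof -
  obtain f :: "nat \<Rightarrow> 'a" where f: "inj f" "range f \<subseteq> S"
    using infinite_countable_subset[OF assms] by blast
  show thesis
  proof
    show "range (\<lambda>n. f (2 * n)) \<subseteq> S" "range (\<lambda>n. f (2 * n + 1)) \<subseteq> S"
      using f(2) by auto
    show "range (\<lambda>n. f (2 * n)) \<inter> range (\<lambda>n. f (2 * n + 1)) = {}"
      by (auto simp: inj_eq[OF f(1)]) presburger
    show "infinite (range (\<lambda>n. f (2 * n)))" "infinite (range (\<lambda>n. f (2 * n + 1)))"
      by (simp_all add: range_inj_infinite inj_def inj_eq[OF f(1)])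
  qed
qed

text \<open>A point \<^term>\<open>p\<close> outside the image would be the common limit of two disjoint infinite sets of
  isolated points, one of which is clopen in \<^term>\<open>X\<close>. The assumption provides a
  neighbourhood of \<^term>\<open>p\<close> in which every other point is isolated.\<close>

lemma stone_cech_map_surj_if_finite_derived_set:
  assumes fin: "finite (stone_cech X derived_set_of topspace (stone_cech X))"
  shows "stone_cech_map X ` topspace X = topspace (stone_cech X)"
proof (rule ccontr)
  let ?K = "stone_cech X"
  let ?N = "?K derived_set_of topspace ?K"
  let ?e = "stone_cech_map X"
  assume "\<not> ?thesis"
  then obtain p where p: "p \<in> topspace ?K" "p \<notin> ?e ` topspace X"
    using stone_cech_map_image_subset'[of X] by blast
  have Haus: "Hausdorff_space ?K" and comp: "compact_space ?K"
    by (simp_all add: Hausdorff_space_stone_cech compact_space_stone_cech)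
  have iso: "x \<in> ?e ` topspace X" "openin ?K {x}" if "x \<in> topspace ?K - ?N" for x
  proof -
    show op: "openin ?K {x}"
      using that by (simp add: derived_set_of_topspace)
    show "x \<in> ?e ` topspace X"
      using dense_stone_cech_map[of X] op unfolding dense_intersects_open by blast
  qed
  have pN: "p \<in> ?N"
    using iso p by blast
  have "closedin ?K (?N - {p})"
    using fin derived_set_of_subset_topspace[of ?K]
    by (intro closedin_Hausdorff_finite[OF Haus]) auto
  then have "openin ?K (topspace ?K - (?N - {p}))"
    by blast
  moreover have "regular_space ?K"
    using comp Haus by (simp add: compact_Hausdorff_imp_regular_space)
  ultimately obtain W C where W: "openin ?K W" "p \<in> W" "W \<subseteq> C"
      and C: "closedin ?K C" "C \<subseteq> topspace ?K - (?N - {p})"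
    using p(1) unfolding neighbourhood_base_of_closedin[symmetric] neighbourhood_base_of
    by (metis Diff_iff insertI1)
  have "infinite (topspace ?K \<inter> W)"
    using pN W unfolding derived_set_of_infinite_openin[OF Haus] by blast
  then have "infinite (C - {p})"
    using W(3) by (metis Int_lower2 finite_Diff2 finite.emptyI finite_insert finite_subset)
  then obtain A B where AB: "A \<subseteq> C - {p}" "B \<subseteq> C - {p}" "A \<inter> B = {}" "infinite A" "infinite B"
    by (rule infinite_disjoint_halves)
  have CN: "C \<inter> ?N \<subseteq> {p}"
    using C(2) by blast
  have dA: "?K derived_set_of A = {p}" and dB: "?K derived_set_of B = {p}"
    using derived_set_of_infinite_subset_eq_singleton[OF comp C(1) CN] AB by auto
  have CX: "C - {p} \<subseteq> topspace ?K - ?N"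
    using C(2) by blast
  have "openin ?K (\<Union>x\<in>A. {x})"
    using iso(2) CX AB(1) by (intro openin_Union) auto
  then have Aop: "openin ?K A"
    by simp
  have "insert p A \<subseteq> C" "infinite (insert p A)"
    using AB(1,4) W(2,3) by auto
  then have "?K derived_set_of (insert p A) = {p}"
    by (rule derived_set_of_infinite_subset_eq_singleton[OF comp C(1) CN])
  then have Acl: "closedin ?K (insert p A)"
    using p(1) openin_subset[OF Aop] unfolding closedin_contains_derived_set by blast
  have cont: "continuous_map X ?K ?e"
    using continuous_map_stone_cech_map_cube[of X] stone_cech_map_image_subset'[of X]
    unfolding topspace_stone_cech stone_cech_def by (auto simp: continuous_map_in_subtopology)
  \<comment> \<open>The only limit point \<^term>\<open>p\<close> of \<^term>\<open>A\<close> is invisible in \<^term>\<open>X\<close>, so \<^term>\<open>A\<close> and the closed set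
    \<^term>\<open>insert p A\<close> have the same preimage.\<close>
  define U where "U = {x \<in> topspace X. ?e x \<in> A}"
  have "openin X U"
    unfolding U_def using openin_continuous_map_preimage[OF cont Aop] .
  moreover have "U = {x \<in> topspace X. ?e x \<in> insert p A}"
    using p(2) by (auto simp: U_def)
  then have "closedin X U"
    using closedin_continuous_map_preimage[OF cont Acl] by simp
  ultimately have disj: "?K closure_of (?e ` U) \<inter> ?K closure_of (?e ` (topspace X - U)) = {}"
    by (rule stone_cech_clopen_disjoint_closures)
  have "A \<subseteq> ?e ` U" "B \<subseteq> ?e ` (topspace X - U)"
    using iso(1) CX AB unfolding U_def by (blast, blast)
  then have "p \<in> ?K closure_of (?e ` U)" "p \<in> ?K closure_of (?e ` (topspace X - U))"
    using p(1) dA dB closure_of_mono[of A "?e ` U" ?K] closure_of_mono[of B "?e ` (topspace X - U)" ?K]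
    by (auto simp: closure_of)
  then show False
    using disj by blast
qed

theorem theorem2p16:
  fixes X :: "'a topology"
  assumes "completely_regular_space X" and "Hausdorff_space X"
    and "submaximal_space (stone_cech X)"
  shows "compact_space X \<and> homeomorphic_map X (stone_cech X) (stone_cech_map X)"
proof -
  have "finite (stone_cech X derived_set_of topspace (stone_cech X))"
    using assms(3) compact_space_stone_cech Hausdorff_space_stone_cech
    by (rule submaximal_compact_finite_derived_set)
  then have "stone_cech_map X ` topspace X = topspace (stone_cech X)"
    by (rule stone_cech_map_surj_if_finite_derived_set)
  then have homeo: "homeomorphic_map X (stone_cech X) (stone_cech_map X)"
    using embedding_map_stone_cech_map[OF assms(1,2)] surjective_embedding_map by blast
  then have "compact_space X"
    using compact_space_stone_cech homeomorphic_compact_space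
      homeomorphic_map_imp_homeomorphic_space by blast
  with homeo show ?thesis
    by blast
qed

end
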